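(* Let $f\in L_{2\pi}$ be a real-valued even function with Fourier series $\frac{a_0}{2}+\sum_{k=1}^\infty a_k\cos kx$. Suppose that $\mathbf{A}=\{a_n\}_{n=0}^{+\infty}$ is a nonnegative sequence and that there are a number $\lambda\ge 2$ and a positive constant $C(\mathbf{A})$ depending only on the sequence $\mathbf{A}$ such that $$\sum_{k=m}^{2m}|\Delta a_k|\le C(\mathbf{A})\frac1m\sum_{k=[\lambda^{-1}m]}^{[\lambda m]}a_k\qquad\text{for all } m=1,2,\dots,$$ where $\Delta a_k=a_{k+1}-a_k$. Then $$\lim_{n\to\infty}\|f-S_n(f)\|_L=0\quad\text{if and only if}\quad\lim_{n\to\infty}a_n\log n=0.$$
   Context: $L_{2\pi}$ is the space of integrable functions of period $2\pi$ with norm $\|f\|_L=\int_{-\pi}^{\pi}|f(x)|\,dx$. For a real-valued even $f$, the Fourier coefficients are $a_k=\frac1\pi\int_{-\pi}^{\pi}f(x)\cos kx\,dx$ and $S_n(f,x)=\frac{a_0}{2}+\sum_{k=1}^{n}a_k\cos kx$. $[x]$ denotes the integer part of $x$. *)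

theory Defs
  imports "HOL-Analysis.Analysis"
begin

definition L_2pi :: "(real \<Rightarrow> real) set" where
  "L_2pi = {f. (\<forall>x. f (x + 2 * pi) = f x) \<and> f absolutely_integrable_on {-pi..pi}}"

definition L_norm :: "(real \<Rightarrow> real) \<Rightarrow> real" where
  "L_norm f = (LINT x:{-pi..pi}|lebesgue. \<bar>f x\<bar>)"

definition fourier_cos_coeff :: "(real \<Rightarrow> real) \<Rightarrow> nat \<Rightarrow> real" where
  "fourier_cos_coeff f k = 1 / pi * (LINT x:{-pi..pi}|lebesgue. f x * cos (real k * x))"

text \<open>Partial sums of the Fourier series; for even \<open>f\<close> the sine coefficients vanish.\<close>

definition fourier_sum :: "nat \<Rightarrow> (real \<Rightarrow> real) \<Rightarrow> real \<Rightarrow> real" where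
  "fourier_sum n f x = fourier_cos_coeff f 0 / 2 + (\<Sum>k=1..n. fourier_cos_coeff f k * cos (real k * x))"

end

theory Submission
  imports Defs
begin

text \<open>
  Write \<open>S\<^sub>n\<close> for the partial sums of \<open>f\<close>, \<open>D\<^sub>k\<close> for the Dirichlet kernels, and \<open>W n\<close> for \<open>1/n\<close> times the
  sum of \<open>a k\<close> over the window \<open>[n/lam] \<le> k \<le> [lam n]\<close>.  The hypothesis says that the variation of \<open>a\<close> on
  the block \<open>{n..2n}\<close> is at most \<open>C * W n\<close>.  Both convergence statements are compared with the condition
  \<open>W n * ln n \<longlonglongrightarrow> 0\<close>.

  Coefficients and window means.  As the window contains the block \<open>{n..2n}\<close>, averaging over the block gives
  \<open>a n \<le> (1 + C) * W n\<close> (\<open>coeff_le_window_mean\<close>).  Conversely, \<open>a n * ln n \<longlonglongrightarrow> 0\<close> implies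
  \<open>W n * ln n \<longlonglongrightarrow> 0\<close>, because logarithms vary by a bounded factor over the window
  (\<open>window_mean_of_log_decay\<close>).

  Sufficiency.  The Fejer means of an even integrable function converge to it in the norm
  (\<open>fejer_converges_even\<close>), hence so do the de la Vallee-Poussin means, the averages of \<open>S\<^sub>k\<close> over
  \<open>n < k \<le> 2n\<close>.  It remains to bound \<open>S\<^sub>k - S\<^sub>n\<close> for these \<open>k\<close>.  Summation by parts and the bound
  \<open>\<parallel>D\<^sub>k\<parallel> \<le> 24 ln k\<close> (\<open>L_norm_dirichlet\<close>) yield a multiple of \<open>ln n\<close> times \<open>a k + a (n + 1)\<close> plus the
  variation of \<open>a\<close> on the block (\<open>L_norm_fourier_sum_diff\<close>), that is, a multiple of \<open>W n * ln n\<close>.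

  Necessity.  Testing \<open>f - S\<^sub>n\<close> against the bounded function \<open>sin (n x) * (\<Sum>j=1..n. sin (j x) / j)\<close> shows that
  the Hardy sums \<open>\<Sum>j=1..n. a (n + j) / j\<close> are at most a constant times \<open>\<parallel>f - S\<^sub>n\<parallel>\<close> (\<open>hardy_sum_le\<close>), so
  they tend to zero.  As all terms are nonnegative, adding the Hardy sums with base point between \<open>n/(2 lam)\<close>
  and \<open>lam n\<close> collects each \<open>a k\<close> of the window with total weight about \<open>ln n\<close>; hence
  \<open>W n * ln n \<longlonglongrightarrow> 0\<close> (\<open>window_mean_of_hardy_sums\<close>).
\<close>

section \<open>Cosine coefficients and partial sums\<close>

abbreviation circ :: "real measure" where
  "circ \<equiv> lebesgue_on {-pi..pi}"

lemma L_norm_eq: "L_norm f = (\<integral>x. \<bar>f x\<bar> \<partial>circ)"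
  unfolding L_norm_def by (simp add: set_lebesgue_integral_def integral_restrict_space)

lemma fourier_cos_coeff_eq: "fourier_cos_coeff f k = (\<integral>x. f x * cos (real k * x) \<partial>circ) / pi"
  unfolding fourier_cos_coeff_def by (simp add: set_lebesgue_integral_def integral_restrict_space)

lemma L_2pi_integrable: "f \<in> L_2pi \<Longrightarrow> integrable circ f"
  by (simp add: L_2pi_def set_integrable_def integrable_restrict_space)

lemma integrable_circ_continuous:
  fixes g :: "real \<Rightarrow> real"
  assumes "continuous_on {-pi..pi} g"
  shows "integrable circ g"
  using assms by (rule continuous_imp_integrable_real)

lemma integrable_circ_mult_continuous:
  fixes f h :: "real \<Rightarrow> real"
  assumes "integrable circ f" and h: "continuous_on {-pi..pi} h"
  shows "integrable circ (\<lambda>x. f x * h x)"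
proof -
  have "f absolutely_integrable_on {-pi..pi}"
    using assms(1) by (simp add: set_integrable_def integrable_restrict_space)
  moreover have "bounded (h ` {-pi..pi})"
    using h compact_continuous_image compact_imp_bounded by blast
  moreover have "h \<in> borel_measurable circ"
    using integrable_circ_continuous[OF h] by simp
  ultimately have "(\<lambda>x. h x * f x) absolutely_integrable_on {-pi..pi}"
    by (intro absolutely_integrable_bounded_measurable_product_real) auto
  then show ?thesis
    by (simp add: set_integrable_def integrable_restrict_space mult.commute)
qed

lemma integral_circ_const: "(\<integral>x. c \<partial>circ) = 2 * pi * (c::real)"
  by (simp add: measure_restrict_space)

lemma integral_cos_int:
  "(\<integral>x. cos (of_int i * x) \<partial>circ) = (if i = 0 then 2 * pi else 0)"
proof (cases "i = 0")
  case False
  have "((\<lambda>x. cos (of_int i * x)) has_integral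
      sin (of_int i * pi) / of_int i - sin (of_int i * (-pi)) / of_int i) {-pi..pi}"
    using False
    by (intro fundamental_theorem_of_calculus)
       (auto intro!: derivative_eq_intros simp: has_real_derivative_iff_has_vector_derivative[symmetric])
  moreover have "sin (of_int i * pi) = 0"
    by (simp add: sin_zero_iff_int2)
  ultimately have "((\<lambda>x. cos (of_int i * x)) has_integral 0) {-pi..pi}"
    by simp
  then have "integral {-pi..pi} (\<lambda>x. cos (of_int i * x)) = 0"
    by (rule integral_unique)
  moreover have "integrable circ (\<lambda>x. cos (of_int i * x))"
    by (intro integrable_circ_continuous continuous_intros)
  ultimately show ?thesis
    using False by (simp add: lebesgue_integral_eq_integral)
qed (use integral_circ_const[of 1] in simp)

lemma integrable_cos [simp]: "integrable circ (\<lambda>x. cos (c * x))"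
  by (intro integrable_circ_continuous continuous_intros)

lemma integral_cos: "(\<integral>x. cos (real k * x) \<partial>circ) = (if k = 0 then 2 * pi else 0)"
  using integral_cos_int[of "int k"] by simp

lemma integral_cos_cos:
  "(\<integral>x. cos (real j * x) * cos (real k * x) \<partial>circ)
     = (if j = k then (if k = 0 then 2 * pi else pi) else 0)"
proof -
  have "cos (real j * x) * cos (real k * x)
      = cos (of_int (int j - int k) * x) / 2 + cos (of_int (int j + int k) * x) / 2" for x :: real
    by (simp add: cos_times_cos left_diff_distrib distrib_right add_divide_distrib)
  then have "(\<integral>x. cos (real j * x) * cos (real k * x) \<partial>circ)
     = (\<integral>x. cos (of_int (int j - int k) * x) \<partial>circ) / 2
       + (\<integral>x. cos (of_int (int j + int k) * x) \<partial>circ) / 2"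
    by simp
  also have "\<dots> = (if j = k then (if k = 0 then 2 * pi else pi) else 0)"
    unfolding integral_cos_int by auto
  finally show ?thesis .
qed

lemma fourier_cos_coeff_cos:
  "fourier_cos_coeff (\<lambda>x. cos (real j * x)) k = (if j = k then (if k = 0 then 2 else 1) else 0)"
  unfolding fourier_cos_coeff_eq integral_cos_cos by simp

lemma fourier_cos_coeff_add:
  assumes "integrable circ f" "integrable circ g"
  shows "fourier_cos_coeff (\<lambda>x. f x + g x) k = fourier_cos_coeff f k + fourier_cos_coeff g k"
proof -
  have "integrable circ (\<lambda>x. f x * cos (real k * x))" "integrable circ (\<lambda>x. g x * cos (real k * x))"
    using assms by (auto intro!: integrable_circ_mult_continuous continuous_intros)
  then show ?thesis
    unfolding fourier_cos_coeff_eq by (simp add: distrib_right add_divide_distrib)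
qed

lemma fourier_cos_coeff_scale: "fourier_cos_coeff (\<lambda>x. c * f x) k = c * fourier_cos_coeff f k"
  unfolding fourier_cos_coeff_eq by (simp add: mult.assoc)

lemma fourier_cos_coeff_diff:
  assumes "integrable circ f" "integrable circ g"
  shows "fourier_cos_coeff (\<lambda>x. f x - g x) k = fourier_cos_coeff f k - fourier_cos_coeff g k"
  using fourier_cos_coeff_add[of f "\<lambda>x. (-1) * g x"] assms
  by (simp add: fourier_cos_coeff_scale[of "-1" g, simplified])

lemma fourier_sum_add:
  assumes "integrable circ f" "integrable circ g"
  shows "fourier_sum n (\<lambda>x. f x + g x) x = fourier_sum n f x + fourier_sum n g x"
  unfolding fourier_sum_def
  by (simp add: fourier_cos_coeff_add[OF assms] sum.distrib distrib_right add_divide_distrib)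

lemma fourier_sum_scale: "fourier_sum n (\<lambda>x. c * f x) x = c * fourier_sum n f x"
  unfolding fourier_sum_def fourier_cos_coeff_scale by (simp add: sum_distrib_left algebra_simps)

lemma continuous_fourier_sum [continuous_intros]: "continuous_on S (fourier_sum n f)"
  unfolding fourier_sum_def by (intro continuous_intros) 

lemma integrable_fourier_sum [simp]: "integrable circ (fourier_sum n f)"
  by (intro integrable_circ_continuous continuous_intros)

lemma integral_fourier_sum: "(\<integral>x. fourier_sum n f x \<partial>circ) = (\<integral>x. f x \<partial>circ)"
proof -
  have "(\<integral>x. fourier_sum n f x \<partial>circ)
      = (\<integral>x. fourier_cos_coeff f 0 / 2 \<partial>circ)
        + (\<Sum>k=1..n. fourier_cos_coeff f k * (\<integral>x. cos (real k * x) \<partial>circ))"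
    unfolding fourier_sum_def
    by (subst Bochner_Integration.integral_add) (auto intro!: integrable_circ_continuous continuous_intros)
  also have "\<dots> = pi * fourier_cos_coeff f 0"
    unfolding integral_cos integral_circ_const by (simp add: sum.neutral)
  finally show ?thesis
    by (simp add: fourier_cos_coeff_eq)
qed

text \<open>
  Orthogonality makes the remainder \<open>f - S\<^sub>n f\<close> blind to frequencies up to \<open>n\<close>; the lower bound on its
  norm in \<open>hardy_sum_le\<close> rests on this.
\<close>

lemma fourier_cos_coeff_fourier_sum:
  "fourier_cos_coeff (fourier_sum n f) k = (if k \<le> n then fourier_cos_coeff f k else 0)"
proof -
  have "fourier_cos_coeff (fourier_sum n f) k
     = (\<integral>x. fourier_cos_coeff f 0 / 2 * (cos (real 0 * x) * cos (real k * x))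
          + (\<Sum>j=1..n. fourier_cos_coeff f j * (cos (real j * x) * cos (real k * x))) \<partial>circ) / pi"
    unfolding fourier_cos_coeff_eq[of "fourier_sum n f"]
    by (simp add: fourier_sum_def distrib_right sum_distrib_right mult.assoc)
  also have "\<dots> = (fourier_cos_coeff f 0 / 2 * (\<integral>x. cos (real 0 * x) * cos (real k * x) \<partial>circ)
       + (\<Sum>j=1..n. fourier_cos_coeff f j * (\<integral>x. cos (real j * x) * cos (real k * x) \<partial>circ))) / pi"
  proof -
    have *: "integrable circ (\<lambda>x. c * (cos (real j * x) * cos (real k * x)))" for c j
      by (intro integrable_circ_continuous continuous_intros)
    show ?thesis
      by (subst Bochner_Integration.integral_add)
         (rule *, rule Bochner_Integration.integrable_sum, rule *,
          simp_all only: Bochner_Integration.integral_sum[OF *] integral_mult_right_zero)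
  qed
  also have "\<dots> = (if k \<le> n then fourier_cos_coeff f k else 0)"
    unfolding integral_cos_cos
    by (cases "k = 0") (auto simp: if_distrib[of "\<lambda>x. _ * x"] sum.delta' cong: if_cong)
  finally show ?thesis .
qed

section \<open>The Fejer kernel and convergence of the Fejer means\<close>

definition dirichlet :: "nat \<Rightarrow> real \<Rightarrow> real" where
  "dirichlet n u = 1/2 + (\<Sum>j=1..n. cos (real j * u))"

text \<open>
  The Fejer kernel is half of \<open>\<bar>\<Sum>k\<le>n. exp (i k u)\<bar>\<^sup>2\<close>, written here with real and imaginary
  parts.  Compared with the usual quotient of sines, the sum of squares shows positivity with no
  special case at the multiples of \<open>2\<pi>\<close>.
\<close>

lemma sum_dirichlet:
  "(\<Sum>k\<le>n. dirichlet k u) = ((\<Sum>k\<le>n. cos (real k * u))\<^sup>2 + (\<Sum>k\<le>n. sin (real k * u))\<^sup>2) / 2"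
proof (induction n)
  case 0
  show ?case by (simp add: dirichlet_def)
next
  case (Suc n)
  let ?c = "cos (real (Suc n) * u)" and ?s = "sin (real (Suc n) * u)"
  have "(\<Sum>k\<le>n. cos (real k * u)) * ?c + (\<Sum>k\<le>n. sin (real k * u)) * ?s
      = (\<Sum>k\<le>n. cos (real (Suc n - k) * u))"
    unfolding sum_distrib_right sum.distrib[symmetric]
  proof (intro sum.cong refl)
    fix k assume "k \<in> {..n}"
    then have "real (Suc n - k) * u = real (Suc n) * u - real k * u"
      by (simp add: of_nat_diff left_diff_distrib)
    then show "cos (real k * u) * ?c + sin (real k * u) * ?s = cos (real (Suc n - k) * u)"
      by (simp only: cos_diff) (simp add: mult.commute)
  qed
  also have "\<dots> = (\<Sum>j=1..Suc n. cos (real j * u))"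
    by (rule sum.reindex_bij_witness[of _ "\<lambda>j. Suc n - j" "\<lambda>k. Suc n - k"]) auto
  finally have *: "(\<Sum>k\<le>n. cos (real k * u)) * ?c + (\<Sum>k\<le>n. sin (real k * u)) * ?s
      = dirichlet (Suc n) u - 1/2"
    by (simp add: dirichlet_def)
  have cs: "?c\<^sup>2 + ?s\<^sup>2 = 1" by (simp add: add.commute)
  have "((\<Sum>k\<le>n. cos (real k * u)) + ?c)\<^sup>2 + ((\<Sum>k\<le>n. sin (real k * u)) + ?s)\<^sup>2
     = (\<Sum>k\<le>n. cos (real k * u))\<^sup>2 + (\<Sum>k\<le>n. sin (real k * u))\<^sup>2
       + 2 * ((\<Sum>k\<le>n. cos (real k * u)) * ?c + (\<Sum>k\<le>n. sin (real k * u)) * ?s) + (?c\<^sup>2 + ?s\<^sup>2)"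
    by (simp add: power2_eq_square algebra_simps)
  then show ?case
    unfolding * cs by (simp add: Suc.IH del: of_nat_Suc)
qed

lemma fejer_kernel_nonneg: "0 \<le> (\<Sum>k\<le>n. dirichlet k u)"
  unfolding sum_dirichlet by simp

definition fejer_mean :: "nat \<Rightarrow> (real \<Rightarrow> real) \<Rightarrow> real \<Rightarrow> real" where
  "fejer_mean n f x = (\<Sum>k\<le>n. fourier_sum k f x) / real (Suc n)"

text \<open>
  The kernel of \<open>S\<^sub>k\<close> symmetrised in both variables: with it the cosine partial sum is an integral over
  the fixed interval \<open>[-\<pi>, \<pi>]\<close>, with no translation of \<open>f\<close>.
\<close>

definition cos_kernel :: "nat \<Rightarrow> real \<Rightarrow> real \<Rightarrow> real" where
  "cos_kernel k x t = 1/2 + (\<Sum>j=1..k. cos (real j * x) * cos (real j * t))"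

lemma fourier_sum_eq_integral:
  assumes "integrable circ f"
  shows "fourier_sum k f x = (\<integral>t. f t * cos_kernel k x t \<partial>circ) / pi"
proof -
  have *: "integrable circ (\<lambda>t. f t * (c * cos (real j * t)))" for c j
    using assms by (intro integrable_circ_mult_continuous continuous_intros)
  have "(\<integral>t. f t * cos_kernel k x t \<partial>circ)
      = (\<integral>t. f t / 2 + (\<Sum>j=1..k. f t * (cos (real j * x) * cos (real j * t))) \<partial>circ)"
    by (simp add: cos_kernel_def distrib_left sum_distrib_left)
  also have "\<dots> = (\<integral>t. f t \<partial>circ) / 2 + (\<Sum>j=1..k. (\<integral>t. f t * (cos (real j * x) * cos (real j * t)) \<partial>circ))"
    using assms by (subst Bochner_Integration.integral_add)
      (auto intro!: Bochner_Integration.integrable_sum * simp: Bochner_Integration.integral_sum[OF *])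
  also have "(\<lambda>j. (\<integral>t. f t * (cos (real j * x) * cos (real j * t)) \<partial>circ))
      = (\<lambda>j. cos (real j * x) * (\<integral>t. f t * cos (real j * t) \<partial>circ))"
    by (subst integral_mult_right_zero[symmetric]) (simp add: algebra_simps)
  finally show ?thesis
    unfolding fourier_sum_def fourier_cos_coeff_eq
    by (simp add: add_divide_distrib sum_divide_distrib mult.commute)
qed

lemma cos_kernel_eq: "cos_kernel k x t = (dirichlet k (x - t) + dirichlet k (x + t)) / 2"
  unfolding cos_kernel_def dirichlet_def cos_times_cos
  by (simp add: add_divide_distrib sum.distrib sum_divide_distrib algebra_simps)

lemma continuous_cos_kernel [continuous_intros]: "continuous_on S (cos_kernel k x)"
  unfolding cos_kernel_def by (intro continuous_intros)

text \<open>
  Positivity of the kernel turns the triangle inequality for the integral into a pointwise bound.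
\<close>

lemma fejer_mean_abs_le:
  assumes f: "integrable circ f"
  shows "\<bar>fejer_mean n f x\<bar> \<le> fejer_mean n (\<lambda>t. \<bar>f t\<bar>) x"
proof -
  define K where "K t = (\<Sum>k\<le>n. cos_kernel k x t)" for t
  have K0: "0 \<le> K t" for t
    unfolding K_def cos_kernel_eq sum_divide_distrib[symmetric] sum.distrib
    by (simp add: fejer_kernel_nonneg)
  have rep: "(\<Sum>k\<le>n. fourier_sum k g x) = (\<integral>t. g t * K t \<partial>circ) / pi" if "integrable circ g" for g
  proof -
    have "integrable circ (\<lambda>t. g t * cos_kernel k x t)" for k
      using that by (intro integrable_circ_mult_continuous continuous_intros)
    then show ?thesis
      by (simp add: fourier_sum_eq_integral[OF that] K_def sum_distrib_left sum_divide_distrib)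
  qed
  have "\<bar>\<integral>t. f t * K t \<partial>circ\<bar> \<le> (\<integral>t. \<bar>f t * K t\<bar> \<partial>circ)"
    by (rule integral_abs_bound)
  also have "\<dots> = (\<integral>t. \<bar>f t\<bar> * K t \<partial>circ)"
    using K0 by (simp add: abs_mult)
  finally have "\<bar>\<Sum>k\<le>n. fourier_sum k f x\<bar> \<le> (\<Sum>k\<le>n. fourier_sum k (\<lambda>t. \<bar>f t\<bar>) x)"
    using f by (simp add: rep abs_divide divide_right_mono)
  then show ?thesis
    by (simp add: fejer_mean_def abs_divide divide_right_mono)
qed

lemma integrable_fejer_mean [simp]: "integrable circ (fejer_mean n f)"
  unfolding fejer_mean_def by simp

lemma integral_fejer_mean: "(\<integral>x. fejer_mean n f x \<partial>circ) = (\<integral>x. f x \<partial>circ)"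
  unfolding fejer_mean_def by (simp add: integral_fourier_sum)

text \<open>
  Integrating the pointwise bound gives a contraction.  The mean of \<open>\<bar>f\<bar>\<close> is a cosine polynomial with the
  integral of \<open>\<bar>f\<bar>\<close>, so its norm can be read off from the constant coefficient.
\<close>

lemma L_norm_fejer_mean_le:
  assumes "integrable circ f"
  shows "L_norm (fejer_mean n f) \<le> L_norm f"
proof -
  have "L_norm (fejer_mean n f) \<le> (\<integral>x. fejer_mean n (\<lambda>t. \<bar>f t\<bar>) x \<partial>circ)"
    unfolding L_norm_eq by (intro integral_mono fejer_mean_abs_le assms) auto
  then show ?thesis
    by (simp add: integral_fejer_mean L_norm_eq)
qed

lemma L_norm_nonneg: "0 \<le> L_norm f"
  unfolding L_norm_eq by (intro integral_nonneg_AE) auto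

lemma L_norm_mono:
  assumes "integrable circ g" "\<And>x. x \<in> {-pi..pi} \<Longrightarrow> \<bar>f x\<bar> \<le> g x" "integrable circ f"
  shows "L_norm f \<le> (\<integral>x. g x \<partial>circ)"
  unfolding L_norm_eq using assms by (intro integral_mono) auto

lemma L_norm_bounded:
  assumes "integrable circ f" "\<And>x. x \<in> {-pi..pi} \<Longrightarrow> \<bar>f x\<bar> \<le> B"
  shows "L_norm f \<le> 2 * pi * B"
  using L_norm_mono[of "\<lambda>_. B" f] assms unfolding integral_circ_const 
  by (simp add: integrable_circ_continuous)

lemma L_norm_add_le:
  assumes "integrable circ f" "integrable circ g"
  shows "L_norm (\<lambda>x. f x + g x) \<le> L_norm f + L_norm g"
proof -
  have "L_norm (\<lambda>x. f x + g x) \<le> (\<integral>x. \<bar>f x\<bar> + \<bar>g x\<bar> \<partial>circ)"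
    using assms by (intro L_norm_mono) auto
  then show ?thesis
    using assms by (simp add: L_norm_eq)
qed

lemma L_norm_scale: "L_norm (\<lambda>x. c * f x) = \<bar>c\<bar> * L_norm f"
  unfolding L_norm_eq by (simp add: abs_mult)

lemma L_norm_minus: "L_norm (\<lambda>x. - f x) = L_norm f"
  unfolding L_norm_eq by simp

lemma L_norm_diff_le:
  assumes "integrable circ f" "integrable circ g"
  shows "L_norm (\<lambda>x. f x - g x) \<le> L_norm f + L_norm g"
  using L_norm_add_le[of f "\<lambda>x. - g x"] assms by (simp add: L_norm_minus)

lemma L_norm_sum_le:
  assumes "\<And>i. i \<in> A \<Longrightarrow> integrable circ (f i)"
  shows "L_norm (\<lambda>x. \<Sum>i\<in>A. f i x) \<le> (\<Sum>i\<in>A. L_norm (f i))"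
proof -
  have "L_norm (\<lambda>x. \<Sum>i\<in>A. f i x) \<le> (\<integral>x. (\<Sum>i\<in>A. \<bar>f i x\<bar>) \<partial>circ)"
    using assms by (intro L_norm_mono) (auto intro: sum_abs)
  then show ?thesis
    using assms by (simp add: L_norm_eq)
qed

lemma L_norm_tendsto_zero:
  assumes "\<And>n. L_norm (F n) \<le> B n" "B \<longlonglongrightarrow> 0"
  shows "(\<lambda>n. L_norm (F n)) \<longlonglongrightarrow> 0"
proof (rule Lim_null_comparison[OF _ assms(2)])
  show "\<forall>\<^sub>F n in sequentially. norm (L_norm (F n)) \<le> B n"
    using assms(1) by (simp add: L_norm_nonneg)
qed

lemma fejer_mean_add:
  assumes "integrable circ f" "integrable circ g"
  shows "fejer_mean n (\<lambda>x. f x + g x) x = fejer_mean n f x + fejer_mean n g x"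
  unfolding fejer_mean_def by (simp add: fourier_sum_add[OF assms] sum.distrib add_divide_distrib)

definition fejer_converges :: "(real \<Rightarrow> real) \<Rightarrow> bool" where
  "fejer_converges f \<longleftrightarrow>
     integrable circ f \<and> (\<lambda>n. L_norm (\<lambda>x. f x - fejer_mean n f x)) \<longlonglongrightarrow> 0"

lemma fejer_converges_add:
  assumes "fejer_converges f" "fejer_converges g"
  shows "fejer_converges (\<lambda>x. f x + g x)"
proof -
  have i: "integrable circ f" "integrable circ g"
    using assms by (auto simp: fejer_converges_def)
  have lim: "(\<lambda>n. L_norm (\<lambda>x. f x - fejer_mean n f x) + L_norm (\<lambda>x. g x - fejer_mean n g x)) \<longlonglongrightarrow> 0"
    using assms by (intro tendsto_add_zero) (auto simp: fejer_converges_def)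
  have "L_norm (\<lambda>x. (f x + g x) - fejer_mean n (\<lambda>x. f x + g x) x)
      \<le> L_norm (\<lambda>x. f x - fejer_mean n f x) + L_norm (\<lambda>x. g x - fejer_mean n g x)" for n
    using L_norm_add_le[of "\<lambda>x. f x - fejer_mean n f x" "\<lambda>x. g x - fejer_mean n g x"] i
    by (simp add: fejer_mean_add algebra_simps)
  then have "(\<lambda>n. L_norm (\<lambda>x. (f x + g x) - fejer_mean n (\<lambda>x. f x + g x) x)) \<longlonglongrightarrow> 0"
    by (rule L_norm_tendsto_zero) (rule lim)
  then show ?thesis
    using i by (simp add: fejer_converges_def)
qed

lemma fourier_sum_cos:
  "fourier_sum n (\<lambda>x. c * cos (real j * x)) x = (if j \<le> n then c * cos (real j * x) else 0)"
  unfolding fourier_sum_scale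
  by (cases "j = 0")
     (auto simp: fourier_sum_def fourier_cos_coeff_cos fourier_cos_coeff_cos[of 0, simplified] if_distrib[of "\<lambda>x. x * _"] sum.delta cong: if_cong)

lemma fejer_converges_cos: "fejer_converges (\<lambda>x. c * cos (real j * x))"
proof -
  let ?f = "\<lambda>x. c * cos (real j * x)"
  have "\<bar>?f x - fejer_mean n ?f x\<bar> \<le> \<bar>c\<bar> * real j / real (Suc n)" for x n
  proof -
    have "?f x - fejer_mean n ?f x = (\<Sum>k\<le>n. ?f x - fourier_sum k ?f x) / real (Suc n)"
      unfolding fejer_mean_def sum_subtractf by (simp add: field_simps)
    moreover have "\<bar>\<Sum>k\<le>n. ?f x - fourier_sum k ?f x\<bar> \<le> \<bar>c\<bar> * real j"
    proof -
      have "\<bar>\<Sum>k\<le>n. ?f x - fourier_sum k ?f x\<bar> \<le> (\<Sum>k\<le>n. if k < j then \<bar>c\<bar> else 0)"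
        by (rule order_trans[OF sum_abs], intro sum_mono)
           (auto simp: fourier_sum_cos abs_mult mult_left_le)
      also have "\<dots> = (\<Sum>k\<in>{..n} \<inter> {k. k < j}. \<bar>c\<bar>)"
        by (subst sum.inter_restrict) auto
      also have "\<dots> \<le> (\<Sum>k<j. \<bar>c\<bar>)"
        by (intro sum_mono2) auto
      finally show ?thesis by (simp add: mult.commute)
    qed
    ultimately show ?thesis
      by (simp add: abs_divide divide_right_mono)
  qed
  then have "L_norm (\<lambda>x. ?f x - fejer_mean n ?f x) \<le> 2 * pi * (\<bar>c\<bar> * real j / real (Suc n))" for n
    by (intro L_norm_bounded) auto
  moreover have "(\<lambda>n. 2 * pi * (\<bar>c\<bar> * real j / real (Suc n))) \<longlonglongrightarrow> 0"
    by (intro tendsto_mult_right_zero LIMSEQ_Suc[OF lim_const_over_n])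
  ultimately have "(\<lambda>n. L_norm (\<lambda>x. ?f x - fejer_mean n ?f x)) \<longlonglongrightarrow> 0"
    by (rule L_norm_tendsto_zero)
  then show ?thesis
    by (simp add: fejer_converges_def)
qed

text \<open>
  Since the Fejer means are contractions, the functions for which they converge form a closed set;
  it then suffices to treat a dense family.
\<close>

lemma fejer_converges_closed:
  assumes f: "integrable circ f"
    and approx: "\<And>e. e > 0 \<Longrightarrow> \<exists>p. fejer_converges p \<and> L_norm (\<lambda>x. f x - p x) < e"
  shows "fejer_converges f"
proof -
  have "\<exists>N. \<forall>n\<ge>N. L_norm (\<lambda>x. f x - fejer_mean n f x) < e" if e: "e > 0" for e
  proof -
    obtain p where p: "fejer_converges p" and fp: "L_norm (\<lambda>x. f x - p x) < e / 3"
      using approx[of "e / 3"] e by auto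
    have ip: "integrable circ p"
      using p by (simp add: fejer_converges_def)
    have ifp: "integrable circ (\<lambda>x. f x - p x)"
      using f ip by simp
    obtain N where N: "\<And>n. n \<ge> N \<Longrightarrow> L_norm (\<lambda>x. p x - fejer_mean n p x) < e / 3"
      using p e LIMSEQ_D[of "\<lambda>n. L_norm (\<lambda>x. p x - fejer_mean n p x)" 0 "e / 3"]
      by (auto simp: fejer_converges_def L_norm_nonneg)
    have "L_norm (\<lambda>x. f x - fejer_mean n f x) < e" if "n \<ge> N" for n
    proof -
      have "fejer_mean n f x = fejer_mean n (\<lambda>x. f x - p x) x + fejer_mean n p x" for x
        using fejer_mean_add[OF ifp ip, of n x] by simp
      then have "(\<lambda>x. f x - fejer_mean n f x)
         = (\<lambda>x. ((f x - p x) - fejer_mean n (\<lambda>x. f x - p x) x) + (p x - fejer_mean n p x))"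
        by (simp add: fun_eq_iff)
      then have "L_norm (\<lambda>x. f x - fejer_mean n f x)
         \<le> L_norm (\<lambda>x. (f x - p x) - fejer_mean n (\<lambda>x. f x - p x) x)
           + L_norm (\<lambda>x. p x - fejer_mean n p x)"
        using f ifp ip by (simp only:) (intro L_norm_add_le Bochner_Integration.integrable_diff integrable_fejer_mean)
      also have "L_norm (\<lambda>x. (f x - p x) - fejer_mean n (\<lambda>x. f x - p x) x)
         \<le> L_norm (\<lambda>x. f x - p x) + L_norm (fejer_mean n (\<lambda>x. f x - p x))"
        using ifp by (intro L_norm_diff_le integrable_fejer_mean)
      also have "L_norm (fejer_mean n (\<lambda>x. f x - p x)) \<le> L_norm (\<lambda>x. f x - p x)"
        by (rule L_norm_fejer_mean_le[OF ifp])
      finally show ?thesis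
        using fp N[OF that] by simp
    qed
    then show ?thesis by blast
  qed
  then show ?thesis
    using f by (auto simp: fejer_converges_def LIMSEQ_def L_norm_nonneg)
qed

inductive cos_poly :: "(real \<Rightarrow> real) \<Rightarrow> bool" where
  cos: "cos_poly (\<lambda>x. c * cos (real j * x))"
| add: "cos_poly p \<Longrightarrow> cos_poly q \<Longrightarrow> cos_poly (\<lambda>x. p x + q x)"

lemma cos_poly_mult_cos: "cos_poly q \<Longrightarrow> cos_poly (\<lambda>x. c * cos (real j * x) * q x)"
proof (induction q rule: cos_poly.induct)
  case (cos d k)
  have "c * cos (real j * x) * (d * cos (real k * x))
      = c * d / 2 * cos (real (nat \<bar>int j - int k\<bar>) * x) + c * d / 2 * cos (real (j + k) * x)" for x
  proof -
    have "cos (real (nat \<bar>int j - int k\<bar>) * x) = cos (real j * x - real k * x)"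
    proof (cases "j \<ge> k")
      case True
      then show ?thesis by (simp add: of_nat_diff left_diff_distrib nat_diff_distrib)
    next
      case False
      then have "real (nat \<bar>int j - int k\<bar>) * x = - (real j * x - real k * x)"
        by (simp add: left_diff_distrib)
      then show ?thesis by (simp only: cos_minus)
    qed
    then show ?thesis
      by (simp add: cos_diff cos_add distrib_right algebra_simps)
  qed
  then show ?case
    by (simp only:) (intro cos_poly.intros)
next
  case (add p q)
  then show ?case
    by (simp only: distrib_left) (rule cos_poly.add)
qed

lemma cos_poly_mult: "cos_poly p \<Longrightarrow> cos_poly q \<Longrightarrow> cos_poly (\<lambda>x. p x * q x)"
proof (induction p rule: cos_poly.induct)
  case (cos c j)
  then show ?case by (rule cos_poly_mult_cos)
next
  case (add p q)
  then show ?case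
    by (simp only: distrib_right) (intro cos_poly.add; simp)
qed

text \<open>
  This is how Weierstrass approximation on \<open>[-1, 1]\<close> enters: the substitution \<open>y = cos x\<close> turns
  algebraic polynomials into cosine polynomials.
\<close>

lemma cos_poly_polynomial_of_cos:
  "real_polynomial_function p \<Longrightarrow> cos_poly (\<lambda>x. p (cos x))"
proof (induction p rule: real_polynomial_function.induct)
  case (linear f)
  then obtain c where "f = (\<lambda>x. x * c)"
    by (auto simp: real_bounded_linear)
  then show ?case
    using cos_poly.cos[of c 1] by (simp add: mult.commute)
next
  case (const c)
  show ?case using cos_poly.cos[of c 0] by simp
next
  case (add f g)
  then show ?case by (intro cos_poly.add)
next
  case (mult f g)
  then show ?case by (intro cos_poly_mult)
qed

lemma cos_poly_fejer_converges: "cos_poly p \<Longrightarrow> fejer_converges p"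
  by (induction p rule: cos_poly.induct) (auto intro: fejer_converges_cos fejer_converges_add)

lemma AE_circ_not_in:
  assumes "negligible N"
  shows "AE x in circ. x \<notin> N"
  using AE_not_in[of N lebesgue] assms
  by (subst AE_restrict_space_iff) (auto simp: negligible_iff_null_sets)

lemma L1_approx_bounded:
  assumes f: "integrable circ f" and e: "e > 0"
  obtains M :: nat where "L_norm (\<lambda>x. f x - max (- real M) (min (real M) (f x))) < e"
proof -
  have [measurable]: "f \<in> borel_measurable circ"
    using f by simp
  have "(\<lambda>M::nat. \<integral>x. \<bar>f x - max (- real M) (min (real M) (f x))\<bar> \<partial>circ) \<longlonglongrightarrow> (\<integral>x. 0 \<partial>circ)"
  proof (rule integral_dominated_convergence)
    show "integrable circ (\<lambda>x. \<bar>f x\<bar>)"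
      using f by simp
    show "AE x in circ. (\<lambda>M::nat. \<bar>f x - max (- real M) (min (real M) (f x))\<bar>) \<longlonglongrightarrow> 0"
    proof (intro AE_I2 tendsto_eventually)
      fix x
      obtain N :: nat where "\<bar>f x\<bar> \<le> real N"
        using real_arch_simple by blast
      then show "\<forall>\<^sub>F M :: nat in sequentially. \<bar>f x - max (- real M) (min (real M) (f x))\<bar> = 0"
        by (intro eventually_sequentiallyI[of N]) (auto simp: min_def max_def)
    qed
  qed (auto simp: min_def max_def)
  then have "(\<lambda>M::nat. L_norm (\<lambda>x. f x - max (- real M) (min (real M) (f x)))) \<longlonglongrightarrow> 0"
    by (simp add: L_norm_eq)
  then have "\<forall>\<^sub>F M in sequentially. L_norm (\<lambda>x. f x - max (- real M) (min (real M) (f x))) < e"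
    using e by (rule order_tendstoD)
  then show thesis
    using that by (auto simp: eventually_sequentially)
qed

text \<open>
  A measurable function is an almost everywhere limit of continuous functions.  Truncating both sides
  at a common height provides the bound that dominated convergence requires.
\<close>

lemma L1_approx_continuous:
  assumes f: "integrable circ f" and e: "e > 0"
  obtains g where "continuous_on UNIV g" "L_norm (\<lambda>x. f x - g x) < e"
proof -
  define T where "T M y = max (- real M) (min (real M) y)" for M :: nat and y :: real
  have bT: "\<bar>T M y\<bar> \<le> real M" for M y
    by (auto simp: T_def)
  obtain M :: nat where M: "L_norm (\<lambda>x. f x - T M (f x)) < e / 2"
    using L1_approx_bounded[OF f, of "e / 2"] e by (auto simp: T_def)
  have [measurable]: "f \<in> borel_measurable circ"
    using f by simp
  then have "f measurable_on {-pi..pi}"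
    by (subst measurable_on_iff_borel_measurable) auto
  then obtain N g where N: "negligible N" and g: "\<And>n. continuous_on UNIV (g n)"
      and lim: "\<And>x. x \<notin> N \<Longrightarrow> (\<lambda>n. g n x) \<longlonglongrightarrow> (if x \<in> {-pi..pi} then f x else 0)"
    unfolding measurable_on_def by blast
  have cT: "continuous_on UNIV (\<lambda>x. T M (g n x))" for n
    unfolding T_def by (intro continuous_intros g)
  have iT: "integrable circ (\<lambda>x. T M (g n x))" for n
    by (intro integrable_circ_continuous continuous_on_subset[OF cT]) auto
  have [measurable]: "(\<lambda>x. T M (g n x)) \<in> borel_measurable circ" for n
    using iT by simp
  have [measurable]: "(\<lambda>x. T M (f x)) \<in> borel_measurable circ"
    unfolding T_def by measurable
  have "(\<lambda>n. \<integral>x. \<bar>T M (f x) - T M (g n x)\<bar> \<partial>circ) \<longlonglongrightarrow> (\<integral>x. 0 \<partial>circ)"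
  proof (rule integral_dominated_convergence)
    show "integrable circ (\<lambda>x. 2 * real M)"
      by (intro integrable_circ_continuous continuous_intros)
    show "AE x in circ. (\<lambda>n. \<bar>T M (f x) - T M (g n x)\<bar>) \<longlonglongrightarrow> 0"
      using AE_circ_not_in[OF N] AE_space
    proof eventually_elim
      case (elim x)
      then have "(\<lambda>n. g n x) \<longlonglongrightarrow> f x"
        using lim[of x] by auto
      then have "(\<lambda>n. \<bar>T M (f x) - T M (g n x)\<bar>) \<longlonglongrightarrow> \<bar>T M (f x) - T M (f x)\<bar>"
        unfolding T_def by (intro tendsto_intros)
      then show ?case by simp
    qed
    show "AE x in circ. norm \<bar>T M (f x) - T M (g n x)\<bar> \<le> 2 * real M" for n
    proof (intro AE_I2)
      fix x
      show "norm \<bar>T M (f x) - T M (g n x)\<bar> \<le> 2 * real M"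
        using bT[of M "f x"] bT[of M "g n x"] by simp
    qed
  qed auto
  then have "(\<lambda>n. L_norm (\<lambda>x. T M (f x) - T M (g n x))) \<longlonglongrightarrow> 0"
    by (simp add: L_norm_eq)
  then have "\<forall>\<^sub>F n in sequentially. L_norm (\<lambda>x. T M (f x) - T M (g n x)) < e / 2"
    using e by (intro order_tendstoD) auto
  then obtain n where n: "L_norm (\<lambda>x. T M (f x) - T M (g n x)) < e / 2"
    by (auto simp: eventually_sequentially)
  have iTf: "integrable circ (\<lambda>x. T M (f x))"
    by (rule Bochner_Integration.integrable_bound[OF f]) (auto simp: T_def)
  have "L_norm (\<lambda>x. f x - T M (g n x))
      = L_norm (\<lambda>x. (f x - T M (f x)) + (T M (f x) - T M (g n x)))"
    by simp
  also have "\<dots> \<le> L_norm (\<lambda>x. f x - T M (f x)) + L_norm (\<lambda>x. T M (f x) - T M (g n x))"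
    using f iTf iT by (intro L_norm_add_le Bochner_Integration.integrable_diff)
  finally have "L_norm (\<lambda>x. f x - T M (g n x)) < e"
    using M n by simp
  with cT show thesis using that by blast
qed

text \<open>
  Averaging an approximation with its reflection does not spoil it, so an even function has
  even continuous approximations.
\<close>

lemma L_norm_even_part_le:
  assumes f: "integrable circ f" and even: "\<And>x. f (- x) = f x" and g: "integrable circ g"
  shows "L_norm (\<lambda>x. f x - (g x + g (- x)) / 2) \<le> L_norm (\<lambda>x. f x - g x)"
proof -
  have reflect: "L_norm (\<lambda>x. f (- x) - g (- x)) = L_norm (\<lambda>x. f x - g x)"
    unfolding L_norm_eq
    using integral_reflect_real[of pi "-pi" "\<lambda>x. \<bar>f x - g x\<bar>"] by simp
  have ir: "integrable circ (\<lambda>x. f (- x) - g (- x))"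
    using f g integrable_reflect_real[of pi "-pi" "\<lambda>x. f x - g x"] by simp
  have "(\<lambda>x. f x - (g x + g (- x)) / 2)
      = (\<lambda>x. 1/2 * (f x - g x) + 1/2 * (f (- x) - g (- x)))"
    by (simp add: fun_eq_iff even field_simps)
  then have "L_norm (\<lambda>x. f x - (g x + g (- x)) / 2)
      \<le> L_norm (\<lambda>x. 1/2 * (f x - g x)) + L_norm (\<lambda>x. 1/2 * (f (- x) - g (- x)))"
    by (simp only:) (intro L_norm_add_le integrable_mult_right ir Bochner_Integration.integrable_diff f g)
  also have "\<dots> = L_norm (\<lambda>x. f x - g x)"
    unfolding L_norm_scale reflect by simp
  finally show ?thesis .
qed

lemma uniform_approx_cos_poly:
  assumes g: "continuous_on {-pi..pi} g" and even: "\<And>x. g (- x) = g x" and e: "e > 0"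
  obtains p where "cos_poly p" "\<And>x. x \<in> {-pi..pi} \<Longrightarrow> \<bar>g x - p x\<bar> < e"
proof -
  have "continuous_on {-1..1} (\<lambda>y. g (arccos y))"
    by (rule continuous_on_compose2[OF g continuous_on_arccos'])
       (use arccos_lbound arccos_ubound pi_ge_zero in \<open>auto, smt (verit)\<close>)
  then obtain q where q: "real_polynomial_function q"
      and gq: "\<And>y. y \<in> {-1..1} \<Longrightarrow> \<bar>g (arccos y) - q y\<bar> < e"
    using e by (metis Stone_Weierstrass_real_polynomial_function compact_Icc)
  have "\<bar>g x - q (cos x)\<bar> < e" if "x \<in> {-pi..pi}" for x
  proof -
    have "arccos (cos x) = \<bar>x\<bar>"
      using that by (intro arccos_cos_eq_abs) auto
    then have "g (arccos (cos x)) = g x"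
      by (simp add: abs_if even)
    then show ?thesis
      using gq[of "cos x"] by simp
  qed
  then show thesis
    using that cos_poly_polynomial_of_cos[OF q] by blast
qed

theorem fejer_converges_even:
  assumes f: "integrable circ f" and even: "\<And>x. f (- x) = f x"
  shows "fejer_converges f"
proof (rule fejer_converges_closed[OF f])
  fix e :: real assume e: "e > 0"
  obtain g where g: "continuous_on UNIV g" and fg: "L_norm (\<lambda>x. f x - g x) < e / 2"
    using L1_approx_continuous[OF f, of "e / 2"] e by auto
  define h where "h x = (g x + g (- x)) / 2" for x
  have h: "continuous_on S h" for S
    unfolding h_def
    by (intro continuous_intros continuous_on_subset[OF g] continuous_on_compose2[OF g]) auto
  obtain p where p: "cos_poly p" and hp: "\<And>x. x \<in> {-pi..pi} \<Longrightarrow> \<bar>h x - p x\<bar> < e / (4 * pi)"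
    using uniform_approx_cos_poly[of h "e / (4 * pi)"] h e
    by (auto simp: h_def add.commute)
  have pc: "fejer_converges p"
    by (rule cos_poly_fejer_converges[OF p])
  then have ip: "integrable circ p"
    by (simp add: fejer_converges_def)
  have ih: "integrable circ h" and ig: "integrable circ g"
    using h by (auto intro!: integrable_circ_continuous continuous_on_subset[OF g])
  have "L_norm (\<lambda>x. f x - p x) = L_norm (\<lambda>x. (f x - h x) + (h x - p x))"
    by simp
  also have "\<dots> \<le> L_norm (\<lambda>x. f x - h x) + L_norm (\<lambda>x. h x - p x)"
    using f ih ip by (intro L_norm_add_le Bochner_Integration.integrable_diff)
  also have "L_norm (\<lambda>x. f x - h x) \<le> L_norm (\<lambda>x. f x - g x)"
    unfolding h_def by (intro L_norm_even_part_le f even ig)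
  also have "L_norm (\<lambda>x. h x - p x) \<le> 2 * pi * (e / (4 * pi))"
    using ih ip hp by (intro L_norm_bounded) (auto intro: less_imp_le)
  also have "2 * pi * (e / (4 * pi)) = e / 2"
    by simp
  finally show "\<exists>p. fejer_converges p \<and> L_norm (\<lambda>x. f x - p x) < e"
    using pc fg by (auto intro!: exI[of _ p])
qed

section \<open>Lebesgue constants and the sufficiency estimate\<close>

lemma sin_half_bound:
  assumes "\<bar>x\<bar> \<le> pi"
  shows "\<bar>x\<bar> \<le> 4 * \<bar>sin (x / 2)\<bar>"
proof -
  define y where "y = \<bar>x\<bar> / 2"
  have "y \<le> 8 / 5" and y0: "0 \<le> y"
    using assms pi_approx by (auto simp: y_def)
  \<comment> \<open>With \<open>y \<le> 8/5\<close> the cubic Taylor error \<open>y^3 / 6\<close> is at most \<open>y / 2\<close>.\<close>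
  then have "y * y\<^sup>2 \<le> y * (8 / 5)\<^sup>2"
    by (intro mult_left_mono power_mono) auto
  moreover have "\<bar>sin y - y\<bar> \<le> y ^ 3 / 6"
    using Maclaurin_sin_bound[of y 3] y0 by (simp add: sin_coeff_def eval_nat_numeral divide_simps)
  ultimately have "y \<le> 2 * sin y"
    using y0 by (simp add: power3_eq_cube power2_eq_square abs_if split: if_splits)
  also have "sin y \<le> \<bar>sin (x / 2)\<bar>"
    by (cases "x \<ge> 0") (auto simp: y_def)
  finally show ?thesis by (simp add: y_def)
qed

lemma dirichlet_sin: "2 * sin (u / 2) * dirichlet n u = sin ((real n + 1/2) * u)"
proof (induction n)
  case 0
  show ?case by (simp add: dirichlet_def mult.commute)
next
  case (Suc n)
  have "dirichlet (Suc n) u = dirichlet n u + cos (real (Suc n) * u)"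
    by (simp add: dirichlet_def)
  then have "2 * sin (u / 2) * dirichlet (Suc n) u
      = sin ((real n + 1/2) * u) + 2 * (sin (u / 2) * cos (real (Suc n) * u))"
    by (simp add: distrib_left Suc.IH del: of_nat_Suc)
  also have "2 * (sin (u / 2) * cos (real (Suc n) * u))
      = sin (u / 2 + real (Suc n) * u) + sin (u / 2 - real (Suc n) * u)"
    unfolding sin_times_cos by simp
  also have "u / 2 - real (Suc n) * u = - ((real n + 1/2) * u)"
    by (simp add: algebra_simps)
  also have "u / 2 + real (Suc n) * u = (real (Suc n) + 1/2) * u"
    by (simp add: algebra_simps)
  finally show ?case by simp
qed

lemma continuous_dirichlet [continuous_intros]: "continuous_on S (dirichlet n)"
  unfolding dirichlet_def by (intro continuous_intros)

lemma integrable_dirichlet [simp]: "integrable circ (dirichlet n)"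
  by (intro integrable_circ_continuous continuous_intros)

text \<open>
  One formula joins the bound \<open>n + 1/2\<close> near the origin with the bound \<open>2 / \<bar>x\<bar>\<close> away from it.  Its
  integral is elementary and logarithmic, which spares splitting the interval at \<open>1 / n\<close>.
\<close>

lemma dirichlet_bound:
  assumes n: "n \<ge> 1" and x: "\<bar>x\<bar> \<le> pi"
  shows "\<bar>dirichlet n x\<bar> \<le> 4 * real n / (1 + real n * \<bar>x\<bar>)"
proof -
  have "\<bar>x\<bar> * \<bar>dirichlet n x\<bar> \<le> 4 * \<bar>sin (x / 2)\<bar> * \<bar>dirichlet n x\<bar>"
    using sin_half_bound[OF x] by (intro mult_right_mono) auto
  also have "\<dots> = 2 * \<bar>sin ((real n + 1/2) * x)\<bar>"
    unfolding dirichlet_sin[symmetric] by (simp add: abs_mult)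
  also have "\<dots> \<le> 2" by simp
  finally have far: "\<bar>x\<bar> * \<bar>dirichlet n x\<bar> \<le> 2" .
  have "\<bar>\<Sum>j=1..n. cos (real j * x)\<bar> \<le> (\<Sum>j=1..n. 1)"
    by (rule order_trans[OF sum_abs], intro sum_mono) simp
  then have near: "\<bar>dirichlet n x\<bar> \<le> 1/2 + real n"
    by (simp add: dirichlet_def)
  have "\<bar>dirichlet n x\<bar> * (1 + real n * \<bar>x\<bar>) = \<bar>dirichlet n x\<bar> + real n * (\<bar>x\<bar> * \<bar>dirichlet n x\<bar>)"
    by (simp add: algebra_simps)
  also have "\<dots> \<le> (1/2 + real n) + real n * 2"
    by (intro add_mono near mult_left_mono far) auto
  also have "\<dots> \<le> 4 * real n"
    using n by simp
  finally show ?thesis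
    by (simp add: pos_le_divide_eq add_pos_nonneg)
qed

lemma L_norm_dirichlet:
  assumes n: "n \<ge> 2"
  shows "L_norm (dirichlet n) \<le> 24 * ln (real n)"
proof -
  let ?g = "\<lambda>x. 4 * real n / (1 + real n * \<bar>x\<bar>)"
  have "((\<lambda>x. 4 * real n / (1 + real n * x)) has_integral
      4 * ln (1 + real n * pi) - 4 * ln (1 + real n * 0)) {0..pi}"
    by (intro fundamental_theorem_of_calculus)
       (auto intro!: derivative_eq_intros add_pos_nonneg simp: has_real_derivative_iff_has_vector_derivative[symmetric])
  then have "((\<lambda>x. 4 * real n / (1 + real n * x)) has_integral 4 * ln (1 + real n * pi)) {0..pi}"
    by simp
  then have right: "(?g has_integral 4 * ln (1 + real n * pi)) {0..pi}"
    by (rule has_integral_eq[rotated]) auto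
  then have "((\<lambda>x. ?g (- x)) has_integral 4 * ln (1 + real n * pi)) {-pi..-0}"
    by (subst has_integral_reflect_real)
  then have left: "(?g has_integral 4 * ln (1 + real n * pi)) {-pi..0}"
    by simp
  have "(?g has_integral 4 * ln (1 + real n * pi) + 4 * ln (1 + real n * pi)) {-pi..pi}"
    by (rule has_integral_combine[OF _ _ left right]) auto
  then have int: "integral {-pi..pi} ?g = 8 * ln (1 + real n * pi)"
    by (simp add: integral_unique)
  have "1 + real n * \<bar>x\<bar> \<noteq> 0" for x
    using add_pos_nonneg[of 1 "real n * \<bar>x\<bar>"] by simp
  then have ig: "integrable circ ?g"
    by (intro integrable_circ_continuous continuous_intros) auto
  have "L_norm (dirichlet n) \<le> (\<integral>x. ?g x \<partial>circ)"
    using n by (intro L_norm_mono ig dirichlet_bound) auto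
  also have "\<dots> = 8 * ln (1 + real n * pi)"
    using lebesgue_integral_eq_integral[OF ig] int by simp
  also have "ln (1 + real n * pi) \<le> ln (real n ^ 3)"
  proof (rule ln_mono)
    have "2 * 2 * real n \<le> real n * real n * real n"
      using n by (intro mult_mono) auto
    moreover have "real n * pi \<le> real n * 3.2"
      using pi_approx by (intro mult_left_mono) auto
    ultimately show "1 + real n * pi \<le> real n ^ 3"
      using n unfolding power3_eq_cube by linarith
  qed (use n in \<open>auto intro: add_pos_nonneg\<close>)
  also have "ln (real n ^ 3) = 3 * ln (real n)"
    using n by (simp add: ln_realpow)
  finally show ?thesis by simp
qed

text \<open>
  Summation by parts: the coefficient differences appear against Dirichlet kernels, whose
  norms grow only logarithmically.
\<close>

lemma fourier_sum_diff_dirichlet: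
  assumes "Suc n \<le> k"
  shows "fourier_sum k f x - fourier_sum n f x
    = fourier_cos_coeff f k * dirichlet k x - fourier_cos_coeff f (Suc n) * dirichlet n x
      - (\<Sum>j=Suc n..<k. (fourier_cos_coeff f (j + 1) - fourier_cos_coeff f j) * dirichlet j x)"
  using assms
proof (induction k rule: dec_induct)
  case base
  show ?case
    by (simp add: fourier_sum_def dirichlet_def algebra_simps)
next
  case (step k)
  have "fourier_sum (Suc k) f x
      = fourier_sum k f x + fourier_cos_coeff f (Suc k) * (dirichlet (Suc k) x - dirichlet k x)"
    by (simp add: fourier_sum_def dirichlet_def)
  then show ?case
    using step by (simp add: algebra_simps)
qed

lemma L_norm_fourier_sum_diff:
  fixes f :: "real \<Rightarrow> real"
  defines "a \<equiv> fourier_cos_coeff f"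
  assumes n: "2 \<le> n" and k: "n < k" "k \<le> 2 * n"
  shows "L_norm (\<lambda>x. fourier_sum k f x - fourier_sum n f x)
    \<le> 24 * ln (real (2 * n)) * (\<bar>a k\<bar> + \<bar>a (n + 1)\<bar> + (\<Sum>j=n..2*n. \<bar>a (j + 1) - a j\<bar>))"
proof -
  let ?L = "24 * ln (real (2 * n))"
  have D: "L_norm (\<lambda>x. c * dirichlet j x) \<le> ?L * \<bar>c\<bar>" if "n \<le> j" "j \<le> 2 * n" for c j
  proof -
    have "L_norm (dirichlet j) \<le> 24 * ln (real j)"
      using that n by (intro L_norm_dirichlet) auto
    also have "\<dots> \<le> ?L"
      using that n by simp
    finally show ?thesis
      unfolding L_norm_scale using mult_right_mono[of "L_norm (dirichlet j)" ?L "\<bar>c\<bar>"]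
      by (simp add: mult.commute)
  qed
  let ?V = "\<lambda>x. \<Sum>j=Suc n..<k. (a (j + 1) - a j) * dirichlet j x"
  have "(\<lambda>x. fourier_sum k f x - fourier_sum n f x)
     = (\<lambda>x. (a k * dirichlet k x - a (n + 1) * dirichlet n x) - ?V x)"
    using k(1) unfolding a_def by (intro ext) (simp add: fourier_sum_diff_dirichlet)
  then have "L_norm (\<lambda>x. fourier_sum k f x - fourier_sum n f x)
      \<le> L_norm (\<lambda>x. a k * dirichlet k x - a (n + 1) * dirichlet n x) + L_norm ?V"
    by (simp only:) (intro L_norm_diff_le; simp)
  moreover have "L_norm (\<lambda>x. a k * dirichlet k x - a (n + 1) * dirichlet n x)
      \<le> L_norm (\<lambda>x. a k * dirichlet k x) + L_norm (\<lambda>x. a (n + 1) * dirichlet n x)"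
    by (intro L_norm_diff_le; simp)
  moreover have "L_norm (\<lambda>x. a k * dirichlet k x) \<le> ?L * \<bar>a k\<bar>"
    using k by (intro D) auto
  moreover have "L_norm (\<lambda>x. a (n + 1) * dirichlet n x) \<le> ?L * \<bar>a (n + 1)\<bar>"
    by (intro D) auto
  moreover have "L_norm ?V \<le> ?L * (\<Sum>j=n..2*n. \<bar>a (j + 1) - a j\<bar>)"
  proof -
    have "L_norm ?V \<le> (\<Sum>j=Suc n..<k. L_norm (\<lambda>x. (a (j + 1) - a j) * dirichlet j x))"
      by (intro L_norm_sum_le) simp
    also have "\<dots> \<le> (\<Sum>j=Suc n..<k. ?L * \<bar>a (j + 1) - a j\<bar>)"
      using k by (intro sum_mono D) auto
    also have "\<dots> \<le> (\<Sum>j=n..2*n. ?L * \<bar>a (j + 1) - a j\<bar>)"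
      using k n by (intro sum_mono2) auto
    finally show ?thesis
      by (simp only: sum_distrib_left)
  qed
  ultimately show ?thesis
    unfolding distrib_left by linarith
qed

text \<open>
  The sum of \<open>S\<^sub>k\<close> over \<open>n < k \<le> 2n\<close> is \<open>(2n+1) \<sigma>\<^bsub>2n\<^esub> - (n+1) \<sigma>\<^sub>n\<close>, where \<open>\<sigma>\<close> denotes a Fejer mean.  Dividing
  by \<open>n\<close> gives the de la Vallee-Poussin mean, which converges to \<open>f\<close> and differs from \<open>S\<^sub>n\<close> by the
  average of the block differences \<open>S\<^sub>k - S\<^sub>n\<close>.
\<close>

lemma L_norm_fourier_sum_le:
  assumes f: "integrable circ f" and n: "n \<ge> 1"
    and R: "\<And>k. n < k \<Longrightarrow> k \<le> 2 * n \<Longrightarrow> L_norm (\<lambda>x. fourier_sum k f x - fourier_sum n f x) \<le> R"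
  shows "L_norm (\<lambda>x. f x - fourier_sum n f x)
    \<le> 3 * L_norm (\<lambda>x. f x - fejer_mean (2 * n) f x) + 2 * L_norm (\<lambda>x. f x - fejer_mean n f x) + R"
proof -
  let ?E = "\<lambda>m x. f x - fejer_mean m f x"
  let ?c = "real (2 * n + 1) / real n" and ?d = "real (n + 1) / real n"
  have id: "f x - fourier_sum n f x = (?c * ?E (2 * n) x - ?d * ?E n x)
      + 1 / real n * (\<Sum>k=n+1..2*n. fourier_sum k f x - fourier_sum n f x)" for x
  proof -
    have "(\<Sum>k\<le>2*n. fourier_sum k f x) = (\<Sum>k\<le>n. fourier_sum k f x) + (\<Sum>k=n+1..2*n. fourier_sum k f x)"
      using sum_up_index_split[of "\<lambda>k. fourier_sum k f x" n n] by (simp add: mult_2)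
    then have eq: "(\<Sum>k=n+1..2*n. fourier_sum k f x)
        = real (2 * n + 1) * fejer_mean (2 * n) f x - real (n + 1) * fejer_mean n f x"
      by (simp add: fejer_mean_def)
    show ?thesis
      unfolding sum_subtractf eq using n by (simp add: field_simps)
  qed
  have iE: "integrable circ (?E m)" for m
    using f by simp
  have "L_norm (\<lambda>x. f x - fourier_sum n f x)
     \<le> L_norm (\<lambda>x. ?c * ?E (2 * n) x - ?d * ?E n x)
       + L_norm (\<lambda>x. 1 / real n * (\<Sum>k=n+1..2*n. fourier_sum k f x - fourier_sum n f x))"
    unfolding id by (intro L_norm_add_le Bochner_Integration.integrable_diff integrable_mult_right iE
        Bochner_Integration.integrable_sum integrable_fourier_sum)
  moreover have "L_norm (\<lambda>x. ?c * ?E (2 * n) x - ?d * ?E n x)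
      \<le> L_norm (\<lambda>x. ?c * ?E (2 * n) x) + L_norm (\<lambda>x. ?d * ?E n x)"
    by (intro L_norm_diff_le integrable_mult_right iE)
  moreover have "L_norm (\<lambda>x. ?c * ?E (2 * n) x) \<le> 3 * L_norm (?E (2 * n))"
    unfolding L_norm_scale using n by (intro mult_right_mono) (auto simp: field_simps L_norm_nonneg)
  moreover have "L_norm (\<lambda>x. ?d * ?E n x) \<le> 2 * L_norm (?E n)"
    unfolding L_norm_scale using n by (intro mult_right_mono) (auto simp: field_simps L_norm_nonneg)
  moreover have "L_norm (\<lambda>x. 1 / real n * (\<Sum>k=n+1..2*n. fourier_sum k f x - fourier_sum n f x)) \<le> R"
  proof -
    have "L_norm (\<lambda>x. \<Sum>k=n+1..2*n. fourier_sum k f x - fourier_sum n f x)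
        \<le> (\<Sum>k=n+1..2*n. L_norm (\<lambda>x. fourier_sum k f x - fourier_sum n f x))"
      by (intro L_norm_sum_le) auto
    also have "\<dots> \<le> (\<Sum>k=n+1..2*n. R)"
      by (intro sum_mono R) auto
    finally show ?thesis
      unfolding L_norm_scale using n by (simp add: field_simps)
  qed
  ultimately show ?thesis by linarith
qed

section \<open>Bounded sine sums and the necessity estimate\<close>

text \<open>
  Summation by parts in a form that can be proved by induction on \<open>n\<close>: the product
  \<open>2 sin (x/2) sin (j x)\<close> telescopes, and the boundary cosine is kept on the left-hand side so that
  each step costs at most \<open>1/n - 1/(n+1)\<close>.
\<close>

lemma sine_series_tail:
  assumes m: "1 \<le> m" "m \<le> n"
  shows "\<bar>2 * sin (x / 2) * (\<Sum>j=m..n. sin (real j * x) / real j) + cos ((real n + 1/2) * x) / real n\<bar>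
    \<le> 2 / real m - 1 / real n"
  using m(2)
proof (induction n rule: dec_induct)
  case base
  have "2 * (sin (x / 2) * sin (real m * x)) = cos ((real m - 1/2) * x) - cos ((real m + 1/2) * x)"
  proof -
    have "x / 2 - real m * x = - ((real m - 1/2) * x)" "x / 2 + real m * x = (real m + 1/2) * x"
      by (simp_all add: algebra_simps)
    then show ?thesis
      unfolding sin_times_sin by simp
  qed
  then have "2 * sin (x / 2) * (\<Sum>j=m..m. sin (real j * x) / real j) + cos ((real m + 1/2) * x) / real m
      = cos ((real m - 1/2) * x) / real m"
    by (simp add: add_divide_distrib[symmetric] algebra_simps)
  then show ?case
    using m(1) by (simp add: abs_divide divide_right_mono diff_divide_distrib[symmetric])
next
  case (step n)
  let ?c = "cos ((real n + 1/2) * x)"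
  have "2 * (sin (x / 2) * sin (real (Suc n) * x)) = ?c - cos ((real (Suc n) + 1/2) * x)"
  proof -
    have "x / 2 - real (Suc n) * x = - ((real n + 1/2) * x)"
         "x / 2 + real (Suc n) * x = (real (Suc n) + 1/2) * x"
      by (simp_all add: algebra_simps)
    then show ?thesis
      unfolding sin_times_sin by simp
  qed
  then have "2 * sin (x / 2) * (sin (real (Suc n) * x) / real (Suc n)) + cos ((real (Suc n) + 1/2) * x) / real (Suc n)
      = ?c / real (Suc n)"
    by (simp add: add_divide_distrib[symmetric] algebra_simps del: of_nat_Suc)
  moreover have "(\<Sum>j=m..Suc n. sin (real j * x) / real j)
      = (\<Sum>j=m..n. sin (real j * x) / real j) + sin (real (Suc n) * x) / real (Suc n)"
    using step by simp
  ultimately have "2 * sin (x / 2) * (\<Sum>j=m..Suc n. sin (real j * x) / real j)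
        + cos ((real (Suc n) + 1/2) * x) / real (Suc n)
      = (2 * sin (x / 2) * (\<Sum>j=m..n. sin (real j * x) / real j) + ?c / real n)
        - ?c * (1 / real n - 1 / real (Suc n))"
    by (simp add: distrib_left right_diff_distrib del: of_nat_Suc)
  also have "\<bar>\<dots>\<bar> \<le> (2 / real m - 1 / real n) + 1 * (1 / real n - 1 / real (Suc n))"
  proof (rule order_trans[OF abs_triangle_ineq4], rule add_mono)
    have "0 \<le> 1 / real n - 1 / real (Suc n)"
      using step m by (simp add: field_simps)
    then show "\<bar>?c * (1 / real n - 1 / real (Suc n))\<bar> \<le> 1 * (1 / real n - 1 / real (Suc n))"
      unfolding abs_mult by (intro mult_mono) auto
  qed (use step in simp)
  finally show ?case by simp
qed

text \<open>
  Terms with \<open>j \<le> 1 / \<bar>x\<bar>\<close> are at most \<open>\<bar>x\<bar>\<close> each and contribute at most 1; the remaining ones are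
  controlled by their oscillation and contribute at most 4.
\<close>

lemma sine_series_bounded:
  assumes x: "\<bar>x\<bar> \<le> pi"
  shows "\<bar>\<Sum>j=1..n. sin (real j * x) / real j\<bar> \<le> 5"
proof (cases "x = 0")
  case False
  define m where "m = nat \<lfloor>1 / \<bar>x\<bar>\<rfloor>"
  have m: "real m \<le> 1 / \<bar>x\<bar>" "1 / \<bar>x\<bar> < real m + 1"
  proof -
    have "real m = of_int \<lfloor>1 / \<bar>x\<bar>\<rfloor>"
      by (simp add: m_def)
    then show "real m \<le> 1 / \<bar>x\<bar>" "1 / \<bar>x\<bar> < real m + 1"
      by linarith+
  qed
  have head: "\<bar>\<Sum>j\<in>A. sin (real j * x) / real j\<bar> \<le> 1" if "A \<subseteq> {1..m}" for A
  proof -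
    have fin: "finite A" using that finite_subset by blast
    have "\<bar>\<Sum>j\<in>A. sin (real j * x) / real j\<bar> \<le> (\<Sum>j\<in>A. \<bar>x\<bar>)"
    proof (rule order_trans[OF sum_abs], rule sum_mono)
      fix j assume "j \<in> A"
      then have "j \<ge> 1" using that by auto
      then show "\<bar>sin (real j * x) / real j\<bar> \<le> \<bar>x\<bar>"
        using abs_sin_x_le_abs_x[of "real j * x"] by (simp add: abs_mult field_simps)
    qed
    also have "\<dots> \<le> real m * \<bar>x\<bar>"
      using card_mono[OF _ that] by (simp add: mult_right_mono)
    also have "\<dots> \<le> 1"
      using m(1) False by (simp add: field_simps)
    finally show ?thesis .
  qed
  show ?thesis
  proof (cases "n \<le> m")
    case True
    then show ?thesis using head[of "{1..n}"] by auto
  next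
    case F: False
    have "{1..n} = {1..m} \<union> {m+1..n}" using F by auto
    then have "(\<Sum>j=1..n. sin (real j * x) / real j)
        = (\<Sum>j=1..m. sin (real j * x) / real j) + (\<Sum>j=m+1..n. sin (real j * x) / real j)"
      by (simp add: sum.union_disjoint)
    moreover have "\<bar>\<Sum>j=m+1..n. sin (real j * x) / real j\<bar> \<le> 4"
    proof -
      let ?T = "\<Sum>j=m+1..n. sin (real j * x) / real j" and ?s = "2 * sin (x / 2)"
      let ?c = "cos ((real n + 1/2) * x) / real n"
      have "\<bar>?s * ?T + ?c\<bar> \<le> 2 / real (m + 1) - 1 / real n"
        using F by (intro sine_series_tail) auto
      moreover have "\<bar>?c\<bar> \<le> 1 / real n"
        by (simp add: abs_divide divide_right_mono)
      ultimately have "\<bar>?s * ?T\<bar> \<le> 2 / real (m + 1)"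
        by linarith
      also have "2 / real (m + 1) \<le> 2 * \<bar>x\<bar>"
        using m(2) False by (simp add: field_simps)
      also have "\<dots> \<le> 2 * (4 * \<bar>sin (x / 2)\<bar>)"
        using sin_half_bound[OF x] by simp
      also have "\<dots> = \<bar>?s\<bar> * 4"
        by (simp add: abs_mult)
      finally have "\<bar>?s\<bar> * \<bar>?T\<bar> \<le> \<bar>?s\<bar> * 4"
        by (simp add: abs_mult)
      moreover have "\<bar>?s\<bar> > 0"
        using sin_half_bound[OF x] False by auto
      ultimately show ?thesis
        by simp
    qed
    ultimately show ?thesis
      using head[of "{1..m}"] by simp
  qed
qed simp

text \<open>
  The function \<open>sin (n x) * (\<Sum>j=1..n. sin (j x) / j)\<close> is bounded by 5 and has the frequencies \<open>n - j\<close>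
  and \<open>n + j\<close>.  The remainder \<open>f - S\<^sub>n f\<close> sees only the latter, with weights \<open>1 / j\<close>.
\<close>

lemma hardy_sum_le:
  assumes f: "integrable circ f"
  shows "\<bar>\<Sum>j=1..n. fourier_cos_coeff f (n + j) / real j\<bar>
    \<le> 10 / pi * L_norm (\<lambda>x. f x - fourier_sum n f x)"
proof -
  define g where "g x = f x - fourier_sum n f x" for x
  have g: "integrable circ g"
    unfolding g_def using f by simp
  have coeff: "fourier_cos_coeff g k = (if k \<le> n then 0 else fourier_cos_coeff f k)" for k
    unfolding g_def by (simp add: fourier_cos_coeff_diff[OF f] fourier_cos_coeff_fourier_sum)
  define T where "T x = sin (real n * x) * (\<Sum>j=1..n. sin (real j * x) / real j)" for x
  have cT: "continuous_on S T" for S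
    unfolding T_def by (intro continuous_intros) auto
  have T5: "\<bar>T x\<bar> \<le> 5" if "x \<in> {-pi..pi}" for x
  proof -
    have "\<bar>T x\<bar> \<le> 1 * 5"
      unfolding T_def abs_mult using that by (intro mult_mono sine_series_bounded) auto
    then show ?thesis by simp
  qed
  have icos: "integrable circ (\<lambda>x. g x * cos (real k * x))" for k
    by (intro integrable_circ_mult_continuous g continuous_intros)
  have "g x * T x = (\<Sum>j=1..n. (g x * cos (real (n - j) * x) - g x * cos (real (n + j) * x)) / (2 * real j))" for x
  proof -
    have "sin (real n * x) * sin (real j * x) = (cos (real (n - j) * x) - cos (real (n + j) * x)) / 2"
      if "j \<in> {1..n}" for j
    proof -
      have "real (n - j) * x = real n * x - real j * x" "real (n + j) * x = real n * x + real j * x"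
        using that by (simp_all add: of_nat_diff algebra_simps)
      then show ?thesis
        unfolding sin_times_sin by (simp only:)
    qed
    then show ?thesis
      unfolding T_def sum_distrib_left
      by (intro sum.cong refl) (simp only: times_divide_eq_right, simp add: diff_divide_distrib right_diff_distrib)
  qed
  then have "(\<integral>x. g x * T x \<partial>circ)
      = (\<Sum>j=1..n. ((\<integral>x. g x * cos (real (n - j) * x) \<partial>circ) - (\<integral>x. g x * cos (real (n + j) * x) \<partial>circ)) / (2 * real j))"
    using icos by (simp del: of_nat_add of_nat_diff)
  also have "\<dots> = (\<Sum>j=1..n. (pi * fourier_cos_coeff g (n - j) - pi * fourier_cos_coeff g (n + j)) / (2 * real j))"
    by (simp add: fourier_cos_coeff_eq)
  also have "\<dots> = (\<Sum>j=1..n. - (pi / 2) * (fourier_cos_coeff f (n + j) / real j))"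
    by (intro sum.cong refl) (auto simp: coeff)
  finally have eq: "(\<integral>x. g x * T x \<partial>circ) = - (pi / 2) * (\<Sum>j=1..n. fourier_cos_coeff f (n + j) / real j)"
    by (simp add: sum_distrib_left)
  have "\<bar>\<integral>x. g x * T x \<partial>circ\<bar> \<le> (\<integral>x. \<bar>g x * T x\<bar> \<partial>circ)"
    by (rule integral_abs_bound)
  also have "\<dots> \<le> (\<integral>x. 5 * \<bar>g x\<bar> \<partial>circ)"
  proof (rule integral_mono)
    show "integrable circ (\<lambda>x. \<bar>g x * T x\<bar>)"
      by (rule integrable_abs[OF integrable_circ_mult_continuous[OF g cT]])
    show "integrable circ (\<lambda>x. 5 * \<bar>g x\<bar>)"
      using g by simp
    fix x assume "x \<in> space circ"
    then have "\<bar>T x\<bar> \<le> 5" by (intro T5) simp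
    then show "\<bar>g x * T x\<bar> \<le> 5 * \<bar>g x\<bar>"
      unfolding abs_mult mult.commute[of "\<bar>g x\<bar>"] by (rule mult_right_mono) simp
  qed
  also have "\<dots> = 5 * L_norm g"
    by (simp add: L_norm_eq)
  finally have "pi / 2 * \<bar>\<Sum>j=1..n. fourier_cos_coeff f (n + j) / real j\<bar> \<le> 5 * L_norm g"
    unfolding eq by (simp add: abs_mult)
  then show ?thesis
    unfolding g_def by (simp add: field_simps)
qed

section \<open>Coefficients of mean value bounded variation\<close>

definition window_mean :: "real \<Rightarrow> (nat \<Rightarrow> real) \<Rightarrow> nat \<Rightarrow> real" where
  "window_mean lam a n = 1 / real n * (\<Sum>k=nat \<lfloor>inverse lam * real n\<rfloor>..nat \<lfloor>lam * real n\<rfloor>. a k)"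

text \<open>
  For large \<open>n\<close> every index of the window is at least \<open>2 sqrt n\<close>, so \<open>ln n\<close> can be replaced, up to a factor 2, by
  the logarithm of half the index.
\<close>

lemma window_lower:
  assumes lam: "lam \<ge> 2" and n: "real n \<ge> 16 * lam\<^sup>2"
  shows "2 * sqrt (real n) \<le> real (nat \<lfloor>inverse lam * real n\<rfloor>)"
proof -
  define s where "s = sqrt (real n)"
  have s: "s * s = real n"
    by (simp add: s_def)
  have "4 * lam \<le> s"
    unfolding s_def using n lam by (intro real_le_rsqrt) (simp add: power2_eq_square)
  then have "2 * lam * (2 * s + 1) \<le> s * (2 * s + 1) / 2"
    using mult_right_mono[of "4 * lam" s "2 * s + 1"] lam by (simp add: algebra_simps)
  moreover have "8 \<le> s"
    using \<open>4 * lam \<le> s\<close> lam by simp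
  then have "s * (2 * s + 1) / 2 \<le> 2 * (s * s)"
    by (simp add: algebra_simps)
  ultimately have "lam * (2 * s + 1) \<le> real n"
    using s by simp
  then have "2 * s + 1 \<le> inverse lam * real n"
    using lam by (simp add: field_simps)
  moreover have "inverse lam * real n - 1 < of_int \<lfloor>inverse lam * real n\<rfloor>"
    by linarith
  moreover have "of_int \<lfloor>inverse lam * real n\<rfloor> \<le> real (nat \<lfloor>inverse lam * real n\<rfloor>)"
    by simp
  ultimately show ?thesis
    unfolding s_def by linarith
qed

lemma window_contains:
  assumes lam: "lam \<ge> (2::real)"
  shows "{n..2 * n} \<subseteq> {nat \<lfloor>inverse lam * real n\<rfloor>..nat \<lfloor>lam * real n\<rfloor>}"
proof -
  have "inverse lam * real n \<le> 1 * real n"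
    using lam by (intro mult_right_mono) (auto simp: field_simps)
  then have 1: "nat \<lfloor>inverse lam * real n\<rfloor> \<le> n"
    by (simp add: nat_le_iff floor_le_iff)
  have "of_int (int (2 * n)) \<le> lam * real n"
    using lam by (simp add: mult_right_mono)
  then have 2: "2 * n \<le> nat \<lfloor>lam * real n\<rfloor>"
    by (simp add: le_nat_iff le_floor_iff)
  show ?thesis using 1 2 by auto
qed

text \<open>
  The two ways of controlling the window mean, by decay of \<open>a n * ln n\<close> and by the Hardy sums, share
  this argument: the logarithmically weighted window sum is dominated by a sum of a null sequence over
  about \<open>lam * n\<close> indices, all of them large.
\<close>

lemma window_mean_tendsto_zero:
  assumes lam: "lam \<ge> 2" and a: "\<And>n. 0 \<le> a n"
    and b: "b \<longlonglongrightarrow> 0" "\<And>n. 0 \<le> b n"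
    and dom: "\<And>P Q. (\<Sum>k=P..Q. ln (real k / 2) * a k) \<le> (\<Sum>m=P div 2..Q. b m)"
  shows "(\<lambda>n. window_mean lam a n * ln (real n)) \<longlonglongrightarrow> 0"
proof (rule LIMSEQ_I)
  fix e :: real assume e: "e > 0"
  \<comment> \<open>Bounding the null sequence by \<open>d\<close> on at most \<open>(lam + 1) * n\<close> indices gives \<open>e / 2\<close> in the end.\<close>
  define d where "d = e / (4 * (lam + 1))"
  have d: "d > 0"
    using e lam by (simp add: d_def)
  obtain N where N: "\<And>m. m \<ge> N \<Longrightarrow> b m \<le> d"
    using LIMSEQ_D[OF b(1) d] b(2) by (force intro: less_imp_le)
  show "\<exists>no. \<forall>n\<ge>no. norm (window_mean lam a n * ln (real n) - 0) < e"
  proof (intro exI allI impI)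
    fix n assume n: "max (nat \<lceil>16 * lam\<^sup>2\<rceil>) ((N + 1)\<^sup>2) \<le> n"
    have n16: "real n \<ge> 16 * lam\<^sup>2"
      using n by linarith
    have "16 * lam\<^sup>2 \<ge> 1"
      using lam power_mono[of 2 lam 2] by simp
    then have n1: "real n \<ge> 1"
      using n16 by simp
    have "real ((N + 1)\<^sup>2) \<le> real n"
      using n by (simp only: of_nat_le_iff)
    then have rN: "real N + 1 \<le> sqrt (real n)"
      by (intro real_le_rsqrt) (simp add: add.commute)
    let ?P = "nat \<lfloor>inverse lam * real n\<rfloor>" and ?Q = "nat \<lfloor>lam * real n\<rfloor>"
    have P: "2 * sqrt (real n) \<le> real ?P"
      by (rule window_lower[OF lam n16])
    have "N \<le> ?P div 2"
      using P rN by linarith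
    have "ln (real n) * (\<Sum>k=?P..?Q. a k) \<le> (\<Sum>k=?P..?Q. 2 * (ln (real k / 2) * a k))"
      unfolding sum_distrib_left
    proof (rule sum_mono)
      fix k assume "k \<in> {?P..?Q}"
      then have "sqrt (real n) \<le> real k / 2"
        using P by simp
      then have "ln (sqrt (real n)) \<le> ln (real k / 2)"
        using n1 by (intro ln_mono) auto
      then have "ln (real n) \<le> 2 * ln (real k / 2)"
        using n1 by (simp add: ln_sqrt)
      then show "ln (real n) * a k \<le> 2 * (ln (real k / 2) * a k)"
        unfolding mult.assoc[symmetric] by (rule mult_right_mono) (rule a)
    qed
    also have "\<dots> \<le> 2 * (\<Sum>m=?P div 2..?Q. b m)"
      unfolding sum_distrib_left[symmetric] using dom[of ?P ?Q] by simp
    also have "(\<Sum>m=?P div 2..?Q. b m) \<le> (\<Sum>m=?P div 2..?Q. d)"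
      using \<open>N \<le> ?P div 2\<close> by (intro sum_mono N) simp
    also have "\<dots> \<le> (\<Sum>m\<in>{0..?Q}. d)"
      using d by (intro sum_mono2) auto
    also have "\<dots> = (real ?Q + 1) * d"
      by simp
    also have "\<dots> \<le> ((lam + 1) * real n) * d"
      using lam n1 d by (intro mult_right_mono) (auto simp: algebra_simps intro!: add_mono of_nat_floor)
    finally have "ln (real n) * (\<Sum>k=?P..?Q. a k) \<le> real n * (2 * ((lam + 1) * d))"
      by (simp add: algebra_simps)
    also have "2 * ((lam + 1) * d) = e / 2"
      using lam by (simp add: d_def field_simps)
    finally have "window_mean lam a n * ln (real n) \<le> e / 2"
      using n1 by (simp add: window_mean_def field_simps)
    moreover have "0 \<le> window_mean lam a n * ln (real n)"
      using n1 a by (simp add: window_mean_def sum_nonneg)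
    ultimately show "norm (window_mean lam a n * ln (real n) - 0) < e"
      using e by simp
  qed
qed

lemma window_mean_of_log_decay:
  assumes lam: "lam \<ge> 2" and a: "\<And>n. 0 \<le> a n" and lim: "(\<lambda>n. a n * ln (real n)) \<longlonglongrightarrow> 0"
  shows "(\<lambda>n. window_mean lam a n * ln (real n)) \<longlonglongrightarrow> 0"
proof (rule window_mean_tendsto_zero[OF lam a lim])
  show nonneg: "0 \<le> a n * ln (real n)" for n
    using a by (cases "n = 0") auto
  fix P Q :: nat
  have "(\<Sum>k=P..Q. ln (real k / 2) * a k) \<le> (\<Sum>k=P..Q. a k * ln (real k))"
  proof (rule sum_mono)
    fix k
    show "ln (real k / 2) * a k \<le> a k * ln (real k)"
      using a by (cases "k = 0") (auto simp: mult.commute intro!: mult_left_mono)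
  qed
  also have "\<dots> \<le> (\<Sum>k=P div 2..Q. a k * ln (real k))"
    by (intro sum_mono2) (auto intro: nonneg)
  finally show "(\<Sum>k=P..Q. ln (real k / 2) * a k) \<le> (\<Sum>k=P div 2..Q. a k * ln (real k))" .
qed

text \<open>
  A single Hardy sum bounds an average of coefficients without the logarithm.  The logarithm is gained by
  adding Hardy sums with different base points \<open>m\<close>: the coefficient \<open>a k\<close> occurs in the sum based at
  \<open>m = k - j\<close> with weight \<open>1 / j\<close> for every \<open>j \<le> k div 2\<close>, altogether with a harmonic number.
\<close>

lemma window_mean_of_hardy_sums:
  assumes lam: "lam \<ge> 2" and a: "\<And>n. 0 \<le> a n"
    and lim: "(\<lambda>n. \<Sum>j=1..n. a (n + j) / real j) \<longlonglongrightarrow> 0"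
  shows "(\<lambda>n. window_mean lam a n * ln (real n)) \<longlonglongrightarrow> 0"
proof (rule window_mean_tendsto_zero[OF lam a lim])
  show "0 \<le> (\<Sum>j=1..n. a (n + j) / real j)" for n
    using a by (intro sum_nonneg) auto
  fix P Q :: nat
  have "(\<Sum>k=P..Q. ln (real k / 2) * a k) \<le> (\<Sum>k=P..Q. \<Sum>j=1..k div 2. a k / real j)"
  proof (rule sum_mono)
    fix k
    have "ln (real k / 2) \<le> ln (real (k div 2) + 1)"
    proof (cases "k = 0")
      case False
      have "k \<le> 2 * (k div 2) + 1" by simp
      then have "real k / 2 \<le> real (k div 2) + 1" by linarith
      then show ?thesis using False by (intro ln_mono) auto
    qed simp
    also have "\<dots> \<le> harm (k div 2)"
      by (rule ln_le_harm)
    finally have "ln (real k / 2) * a k \<le> harm (k div 2) * a k"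
      by (rule mult_right_mono) (rule a)
    also have "\<dots> = (\<Sum>j=1..k div 2. a k / real j)"
      unfolding harm_def sum_distrib_right by (simp add: divide_inverse mult.commute)
    finally show "ln (real k / 2) * a k \<le> (\<Sum>j=1..k div 2. a k / real j)" .
  qed
  also have "\<dots> = (\<Sum>(k, j)\<in>Sigma {P..Q} (\<lambda>k. {1..k div 2}). a k / real j)"
    by (subst sum.Sigma) auto
  \<comment> \<open>Regroup the pairs by the base point \<open>m = k - j\<close>; then \<open>j \<le> k div 2\<close> becomes \<open>j \<le> m\<close>.\<close>
  also have "\<dots> = (\<Sum>(m, j)\<in>(\<lambda>(k, j). (k - j, j)) ` Sigma {P..Q} (\<lambda>k. {1..k div 2}). a (m + j) / real j)"
    by (subst sum.reindex) (force simp: inj_on_def intro!: sum.cong)+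
  also have "\<dots> \<le> (\<Sum>(m, j)\<in>Sigma {P div 2..Q} (\<lambda>m. {1..m}). a (m + j) / real j)"
  proof (rule sum_mono2)
    show "(\<lambda>(k, j). (k - j, j)) ` Sigma {P..Q} (\<lambda>k. {1..k div 2}) \<subseteq> Sigma {P div 2..Q} (\<lambda>m. {1..m})"
      by auto
  qed (use a in auto)
  also have "\<dots> = (\<Sum>m=P div 2..Q. \<Sum>j=1..m. a (m + j) / real j)"
    by (subst sum.Sigma) auto
  finally show "(\<Sum>k=P..Q. ln (real k / 2) * a k) \<le> (\<Sum>m=P div 2..Q. \<Sum>j=1..m. a (m + j) / real j)" .
qed

lemma diff_le_variation:
  fixes a :: "nat \<Rightarrow> real"
  assumes "n \<le> k" "k \<le> 2 * n + 1"
  shows "\<bar>a k - a n\<bar> \<le> (\<Sum>j=n..2*n. \<bar>a (j + 1) - a j\<bar>)"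
proof -
  have "a k - a n = (\<Sum>j=n..<k. a (j + 1) - a j)"
    using sum_Suc_diff'[OF assms(1), of a] by simp
  also have "\<bar>\<dots>\<bar> \<le> (\<Sum>j=n..<k. \<bar>a (j + 1) - a j\<bar>)"
    by (rule sum_abs)
  also have "\<dots> \<le> (\<Sum>j=n..2*n. \<bar>a (j + 1) - a j\<bar>)"
    using assms by (intro sum_mono2) auto
  finally show ?thesis .
qed

text \<open>
  On the block from \<open>n\<close> to \<open>2n\<close> no coefficient falls below \<open>a n\<close> by more than the variation of the block.
\<close>

lemma coeff_le_window_mean:
  assumes lam: "lam \<ge> 2" and a: "\<And>n. 0 \<le> a n" and n: "n \<ge> 1"
    and var: "(\<Sum>j=n..2*n. \<bar>a (j + 1) - a j\<bar>) \<le> C * window_mean lam a n"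
  shows "a n \<le> (1 + C) * window_mean lam a n"
proof -
  let ?V = "\<Sum>j=n..2*n. \<bar>a (j + 1) - a j\<bar>"
  let ?S = "\<Sum>k=nat \<lfloor>inverse lam * real n\<rfloor>..nat \<lfloor>lam * real n\<rfloor>. a k"
  have "real n * (a n - ?V) = (\<Sum>k\<in>{n..<2*n}. a n - ?V)"
    by simp
  also have "\<dots> \<le> (\<Sum>k\<in>{n..<2*n}. a k)"
  proof (rule sum_mono)
    fix k assume "k \<in> {n..<2*n}"
    then have "\<bar>a k - a n\<bar> \<le> ?V"
      by (intro diff_le_variation) auto
    then show "a n - ?V \<le> a k" by linarith
  qed
  also have "\<dots> \<le> ?S"
    using window_contains[OF lam, of n] a by (intro sum_mono2) auto
  finally have "a n - ?V \<le> window_mean lam a n"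
    using n by (simp add: window_mean_def field_simps)
  then show ?thesis
    using var by (simp add: distrib_right)
qed

theorem L1_convergence_iff_log_decay:
  fixes f :: "real \<Rightarrow> real" and a :: "nat \<Rightarrow> real"
  assumes f: "integrable circ f" and even: "\<And>x. f (- x) = f x"
    and coeff: "\<And>n. a n = fourier_cos_coeff f n" and a: "\<And>n. 0 \<le> a n"
    and lam: "lam \<ge> 2" and C: "C > 0"
    and var: "\<And>m. m \<ge> 1 \<Longrightarrow> (\<Sum>j=m..2*m. \<bar>a (j + 1) - a j\<bar>) \<le> C * window_mean lam a m"
  shows "(\<lambda>n. L_norm (\<lambda>x. f x - fourier_sum n f x)) \<longlonglongrightarrow> 0
     \<longleftrightarrow> (\<lambda>n. a n * ln (real n)) \<longlonglongrightarrow> 0"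
proof
  let ?W = "\<lambda>n. window_mean lam a n * ln (real n)"
  have a_eq: "a = fourier_cos_coeff f"
    using coeff by auto
  {
    assume conv: "(\<lambda>n. L_norm (\<lambda>x. f x - fourier_sum n f x)) \<longlonglongrightarrow> 0"
    have "(\<lambda>n. \<Sum>j=1..n. a (n + j) / real j) \<longlonglongrightarrow> 0"
    proof (rule Lim_null_comparison)
      show "\<forall>\<^sub>F n in sequentially. norm (\<Sum>j=1..n. a (n + j) / real j)
          \<le> 10 / pi * L_norm (\<lambda>x. f x - fourier_sum n f x)"
        using hardy_sum_le[OF f] by (simp add: a_eq)
      show "(\<lambda>n. 10 / pi * L_norm (\<lambda>x. f x - fourier_sum n f x)) \<longlonglongrightarrow> 0"
        by (rule tendsto_mult_right_zero[OF conv])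
    qed
    then have W: "?W \<longlonglongrightarrow> 0"
      by (rule window_mean_of_hardy_sums[OF lam a])
    show "(\<lambda>n. a n * ln (real n)) \<longlonglongrightarrow> 0"
    proof (rule Lim_null_comparison)
      show "(\<lambda>n. (1 + C) * ?W n) \<longlonglongrightarrow> 0"
        by (rule tendsto_mult_right_zero[OF W])
      show "\<forall>\<^sub>F n in sequentially. norm (a n * ln (real n)) \<le> (1 + C) * ?W n"
      proof (rule eventually_sequentiallyI[of 1])
        fix n :: nat assume n: "1 \<le> n"
        have "a n * ln (real n) \<le> ((1 + C) * window_mean lam a n) * ln (real n)"
          using n by (intro mult_right_mono coeff_le_window_mean lam a var) auto
        then show "norm (a n * ln (real n)) \<le> (1 + C) * ?W n"
          using n a by (simp add: mult.assoc)
      qed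
    qed
  }
  assume "(\<lambda>n. a n * ln (real n)) \<longlonglongrightarrow> 0"
  then have W: "?W \<longlonglongrightarrow> 0"
    by (rule window_mean_of_log_decay[OF lam a])
  define E where "E n = L_norm (\<lambda>x. f x - fejer_mean n f x)" for n
  have E: "E \<longlonglongrightarrow> 0"
    unfolding E_def using fejer_converges_even[OF f even] by (simp add: fejer_converges_def)
  have "(\<lambda>n. E (2 * n)) \<longlonglongrightarrow> 0"
    using LIMSEQ_subseq_LIMSEQ[OF E, of "\<lambda>n. 2 * n"] by (simp add: strict_mono_def comp_def)
  then have lim: "(\<lambda>n. 3 * E (2 * n) + 2 * E n + 48 * (2 + 5 * C) * ?W n) \<longlonglongrightarrow> 0"
    by (intro tendsto_add_zero tendsto_mult_right_zero E W)
  show "(\<lambda>n. L_norm (\<lambda>x. f x - fourier_sum n f x)) \<longlonglongrightarrow> 0"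
  proof (rule Lim_null_comparison[OF _ lim], rule eventually_sequentiallyI[of 2])
    fix n :: nat assume n: "2 \<le> n"
    let ?V = "\<Sum>j=n..2*n. \<bar>a (j + 1) - a j\<bar>" and ?M = "window_mean lam a n"
    have V: "?V \<le> C * ?M"
      using n by (intro var) auto
    have an: "a n \<le> (1 + C) * ?M"
      using n by (intro coeff_le_window_mean lam a var) auto
    have "L_norm (\<lambda>x. fourier_sum k f x - fourier_sum n f x) \<le> 48 * (2 + 5 * C) * ?W n"
      if k: "n < k" "k \<le> 2 * n" for k
    proof -
      have "\<bar>a k - a n\<bar> \<le> ?V" "\<bar>a (n + 1) - a n\<bar> \<le> ?V"
        using k by (intro diff_le_variation; simp)+
      then have bracket: "\<bar>a k\<bar> + \<bar>a (n + 1)\<bar> + ?V \<le> (2 + 5 * C) * ?M"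
        using a[of k] a[of "n + 1"] V an by (simp add: distrib_right)
      have "ln (real (2 * n)) = ln 2 + ln (real n)"
        using n by (simp add: ln_mult)
      also have "\<dots> \<le> 2 * ln (real n)"
        using n by simp
      finally have logs: "24 * ln (real (2 * n)) \<le> 48 * ln (real n)"
        by simp
      have "L_norm (\<lambda>x. fourier_sum k f x - fourier_sum n f x)
          \<le> 24 * ln (real (2 * n)) * (\<bar>a k\<bar> + \<bar>a (n + 1)\<bar> + ?V)"
        unfolding a_eq by (rule L_norm_fourier_sum_diff[OF n k])
      also have "\<dots> \<le> 48 * ln (real n) * ((2 + 5 * C) * ?M)"
        using n by (intro mult_mono logs bracket) (auto intro!: add_nonneg_nonneg sum_nonneg)
      finally show ?thesis
        by (simp add: mult_ac)
    qed
    then have "L_norm (\<lambda>x. f x - fourier_sum n f x) \<le> 3 * E (2 * n) + 2 * E n + 48 * (2 + 5 * C) * ?W n"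
      unfolding E_def using n by (intro L_norm_fourier_sum_le f) auto
    then show "norm (L_norm (\<lambda>x. f x - fourier_sum n f x)) \<le> 3 * E (2 * n) + 2 * E n + 48 * (2 + 5 * C) * ?W n"
      by (simp add: L_norm_nonneg)
  qed
qed

theorem corollary2:
  fixes f :: "real \<Rightarrow> real" and a :: "nat \<Rightarrow> real"
  assumes "f \<in> L_2pi"
    and "\<And>x. f (- x) = f x"
    and "\<And>n. a n = fourier_cos_coeff f n"
    and "\<And>n. 0 \<le> a n"
    and "\<exists>lam::real. lam \<ge> 2 \<and> (\<exists>C::real. C > 0 \<and> (\<forall>m::nat. m \<ge> 1 \<longrightarrow>
           (\<Sum>k=m..2*m. \<bar>a (k + 1) - a k\<bar>)
             \<le> C * (1 / real m) * (\<Sum>k=nat \<lfloor>inverse lam * real m\<rfloor>..nat \<lfloor>lam * real m\<rfloor>. a k)))"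
  shows "(\<lambda>n. L_norm (\<lambda>x. f x - fourier_sum n f x)) \<longlonglongrightarrow> 0
     \<longleftrightarrow> (\<lambda>n. a n * ln (real n)) \<longlonglongrightarrow> 0"
proof -
  obtain lam C :: real where "lam \<ge> 2" "C > 0"
    and "\<And>m. m \<ge> 1 \<Longrightarrow> (\<Sum>j=m..2*m. \<bar>a (j + 1) - a j\<bar>) \<le> C * window_mean lam a m"
    using assms(5) unfolding window_mean_def mult.assoc by blast
  then show ?thesis
    by (rule L1_convergence_iff_log_decay[OF L_2pi_integrable[OF assms(1)] assms(2-4)])
qed

end
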